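(* Let $\mathcal{G}=(\mathcal{V},\mathcal{E})$, $\mathcal{V}=\{1,\dots,n\}$, be a strongly connected digraph, and assume that no agent $i\in\mathcal{V}$ knows the structure (Laplacian) of the whole network, so that the data available to an adversary about a run are exactly its information set defined in the context. Let $j\in\mathcal{V}$. Under the PrFTPS algorithm (described in the context), the privacy of agent $j$ (i.e. of its private input $x_j(0)$, which is its local gradient value $\nabla f_j(x_j)$ at any point $x_j$ when the algorithm is used for distributed optimization) is preserved in the following cases: 1) against a set $\mathcal{N}\subseteq\mathcal{V}$ of honest-but-curious nodes with $j\notin\mathcal{N}$, if at least one neighbour of node $j$ does not belong to $\mathcal{N}$, i.e. $N_j^+\cup N_j^-\nsubseteq\mathcal{N}$: one has $\mathrm{Diam}\{\Delta\mathcal{I}_{\mathcal{N}}(x_j(0))\}=\infty$; 2) against an eavesdropper $\mathcal{R}$ listening to the set of edges $\mathcal{E}_{\mathcal{R}}\subseteq\mathcal{E}$, if there exists an edge $\varepsilon_{mj}$ with $m\in N_j^+$, or an edge $\varepsilon_{jm}$ with $m\in N_j^-$, that $\mathcal{R}$ cannot eavesdrop (i.e. that is not in $\mathcal{E}_{\mathcal{R}}$): one has $\mathrm{Diam}\{\Delta\mathcal{I}_{\mathcal{R}}(x_j(0))\}=\infty$.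
   Context: **Graph notation.** An edge $\varepsilon_{ji}=(j,i)\in\mathcal{E}$ means node $i$ can send messages to node $j$. $N_i^-=\{j\in\mathcal{V}:\varepsilon_{ij}\in\mathcal{E}\}$ (in-neighbours), $N_i^+=\{j\in\mathcal{V}:\varepsilon_{ji}\in\mathcal{E}\}$ (out-neighbours), $\mathcal{D}_i^+=|N_i^+|$. **PrFTPS iteration.** Each node $i$ has a private real initial state $x_i(0)$ (vector states are treated componentwise; inside the gradient method the input state of node $i$ is its local gradient). For $l=1,2$ it keeps two substates: $x^\alpha_{i,l}(k)$, which is sent to out-neighbours, and $x^\beta_{i,l}(k)$, which is never shared. The initial values are arbitrary reals subject to $x_{i,1}^\alpha(0)+x_{i,1}^\beta(0)=2x_i(0)$, $x_{i,2}^\alpha(0)=0$, $x_{i,2}^\beta(0)=2$. For $k\ge0$, $$x_{i,l}^\alpha(k+1)=\sum_{h\in N_i^-\cup\{i\}}p_{ih}(k)x_{h,l}^\alpha(k)+a_i^{\alpha,\beta}(k)x_{i,l}^\beta(k),\qquad x_{i,l}^\beta(k+1)=a_i^{\beta,\alpha}(k)x_{i,l}^\alpha(k)+a_i^{\beta,\beta}(k)x_{i,l}^\beta(k).$$ Weights at $k=0$: $a_i^{\beta,\beta}(0)=0$, $a_i^{\alpha,\beta}(0)=1$, $p_{hi}(0)=0$ for $h\notin N_i^+\cup\{i\}$, and $p_{hi}(0)$ ($h\in N_i^+\cup\{i\}$) and $a_i^{\beta,\alpha}(0)$ are arbitrary reals with $\sum_{h=1}^np_{hi}(0)+a_i^{\beta,\alpha}(0)=1$.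 Weights at $k\ge1$: $p_{hi}(k)=\frac1{2+\mathcal{D}_i^+}$ for $h\in N_i^+\cup\{i\}$ and $0$ otherwise, $a_i^{\beta,\alpha}(k)=\frac1{2+\mathcal{D}_i^+}$, $a_i^{\beta,\beta}(k)=a_i^{\alpha,\beta}(k)=\frac12$. The iteration is run for a finite number of communication rounds, at most $k_1$ (after which each node locally computes the average of the initial states from its own sequences $x^\alpha_{j,1}(\cdot),x^\alpha_{j,2}(\cdot)$). **Adversaries.** An honest-but-curious adversary is a node or group of nodes $\mathcal{N}$ which follows the protocol and attempts to infer the private information of other nodes; its information at time $k$ is $$\mathcal{I}_{\mathcal{N}}(k)=\{x_{a,l}^\alpha(k),\,x_{a,l}^\beta(k),\,p_{ha}(k),\,p_{aq}(k),\,x_{q,l}^\alpha(k)\mid a\in\mathcal{N},\ q\in N_a^-,\ h\in\mathcal{V},\ l=1,2\}.$$ An eavesdropper $\mathcal{R}$ is an external adversary that eavesdrops on the edges in $\mathcal{E}_{\mathcal{R}}\subseteq\mathcal{E}$; its information at time $k$ is $$\mathcal{I}_{\mathcal{R}}(k)=\{x_{h,l}^\alpha(k),\,p_{ih}(k)\mid \varepsilon_{ih}\in\mathcal{E}_{\mathcal{R}},\ l=1,2\}.$$ For an adversary $\mathcal{A}\in\{\mathcal{N},\mathcal{R}\}$ put $\mathcal{I}_{\mathcal{A}}(0:K)=\{\mathcal{I}_{\mathcal{A}}(0),\dots,\mathcal{I}_{\mathcal{A}}(K)\}$, with $K=k_1$. **Privacy notion.** Given an actual run with adversary information $\mathcal{I}_{\mathcal{A}}(0:K)$,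 $\Delta\mathcal{I}_{\mathcal{A}}(x_j(0))$ is the set of all values $\bar x_j$ of the private state of node $j$ that are consistent with this information, i.e. for which there is a run of the algorithm (admissible initial substates and admissible weights) in which node $j$'s private initial state is $\bar x_j$ and the adversary's information is the same $\mathcal{I}_{\mathcal{A}}(0:K)$. Its diameter is $\mathrm{Diam}\{\Delta\mathcal{I}_{\mathcal{A}}(x_j(0))\}=\sup|\bar x_j-\bar x_j'|$ over $\bar x_j,\bar x_j'\in\Delta\mathcal{I}_{\mathcal{A}}(x_j(0))$. Privacy of $x_j(0)$ is preserved against $\mathcal{A}$ if this diameter is $\infty$. In distributed optimization, the privacy of agent $j$ is said to be preserved if the privacy of its gradient value $\nabla f_j(x_j)$ evaluated at any point $x_j$ is preserved.
   Formalization: The hidden edge at j is also required to have a sender h whose initial shared substate x^α_{h,1}(0) is not observed by the adversary to be 0; if it is observed as 0, x_j(0) can be determined exactly and the claim fails. Self-loops are excluded. *)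

theory Defs
  imports
    "HOL-Library.Extended_Real"
    "Graph_Theory.Pair_Digraph"
    "Graph_Theory.Digraph_Component"
begin

text \<open>
  An arc \<open>(j, i)\<close> means that node \<open>i\<close> can send messages to node \<open>j\<close>: information flows from the
  second to the first component.
\<close>

definition in_nbrs :: "'v pair_pre_digraph \<Rightarrow> 'v \<Rightarrow> 'v set" where
  "in_nbrs G i = {j \<in> pverts G. (i, j) \<in> parcs G}"

definition out_nbrs :: "'v pair_pre_digraph \<Rightarrow> 'v \<Rightarrow> 'v set" where
  "out_nbrs G i = {j \<in> pverts G. (j, i) \<in> parcs G}"

definition out_deg :: "'v pair_pre_digraph \<Rightarrow> 'v \<Rightarrow> nat" where
  "out_deg G i = card (out_nbrs G i)"

text \<open>
  The data of a run. \<open>x0 r i\<close> is the private initial state of node \<open>i\<close>;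
  \<open>xa r l k i\<close> and \<open>xb r l k i\<close> are its shared and unshared substates \<open>x\<^sup>\<alpha>\<close>, \<open>x\<^sup>\<beta>\<close> with index
  \<open>l \<in> {1, 2}\<close> at time \<open>k\<close>; \<open>p r k i h\<close> is the weight of the message from \<open>h\<close> to \<open>i\<close>;
  \<open>a_ab\<close>, \<open>a_ba\<close>, \<open>a_bb\<close> are the weights with superscripts \<open>\<alpha>,\<beta>\<close>, \<open>\<beta>,\<alpha>\<close>, \<open>\<beta>,\<beta>\<close>.
\<close>

record 'v run =
  x0 :: "'v \<Rightarrow> real"
  xa :: "nat \<Rightarrow> nat \<Rightarrow> 'v \<Rightarrow> real"
  xb :: "nat \<Rightarrow> nat \<Rightarrow> 'v \<Rightarrow> real"
  p :: "nat \<Rightarrow> 'v \<Rightarrow> 'v \<Rightarrow> real"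
  a_ab :: "nat \<Rightarrow> 'v \<Rightarrow> real"
  a_ba :: "nat \<Rightarrow> 'v \<Rightarrow> real"
  a_bb :: "nat \<Rightarrow> 'v \<Rightarrow> real"

definition admissible_init :: "'v pair_pre_digraph \<Rightarrow> 'v run \<Rightarrow> bool" where
  "admissible_init G r \<longleftrightarrow> (\<forall>i\<in>pverts G.
     xa r 1 0 i + xb r 1 0 i = 2 * x0 r i \<and> xa r 2 0 i = 0 \<and> xb r 2 0 i = 2)"

definition admissible_weights :: "'v pair_pre_digraph \<Rightarrow> 'v run \<Rightarrow> bool" where
  "admissible_weights G r \<longleftrightarrow> (\<forall>i\<in>pverts G.
     a_bb r 0 i = 0 \<and> a_ab r 0 i = 1 \<and>
     (\<forall>h\<in>pverts G. h \<notin> insert i (out_nbrs G i) \<longrightarrow> p r 0 h i = 0) \<and>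
     (\<Sum>h\<in>pverts G. p r 0 h i) + a_ba r 0 i = 1 \<and>
     (\<forall>k\<ge>1.
        (\<forall>h\<in>pverts G. p r k h i =
           (if h \<in> insert i (out_nbrs G i) then 1 / (2 + real (out_deg G i)) else 0)) \<and>
        a_ba r k i = 1 / (2 + real (out_deg G i)) \<and>
        a_bb r k i = 1 / 2 \<and> a_ab r k i = 1 / 2))"

text \<open>
  A run is continued over all times \<open>k\<close>. From time 1 on it is determined by the state at time 1,
  so a run of any finite length has exactly one such continuation.
\<close>

definition prftps_run :: "'v pair_pre_digraph \<Rightarrow> 'v run \<Rightarrow> bool" where
  "prftps_run G r \<longleftrightarrow> admissible_init G r \<and> admissible_weights G r \<and>
     (\<forall>i\<in>pverts G. \<forall>l\<in>{1, 2}. \<forall>k.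
        xa r l (Suc k) i =
          (\<Sum>h\<in>insert i (in_nbrs G i). p r k i h * xa r l k h) + a_ab r k i * xb r l k i \<and>
        xb r l (Suc k) i = a_ba r k i * xa r l k i + a_bb r k i * xb r l k i)"

text \<open>
  An adversary's information is a set of labelled observations: the labels record which quantity
  (substate index, node, edge) a value belongs to. \<open>Obs_p i h v\<close> says that \<open>p\<^sub>i\<^sub>h\<close> has the value \<open>v\<close>.
\<close>

datatype 'v obs =
    Obs_alpha nat 'v real
  | Obs_beta nat 'v real
  | Obs_p 'v 'v real

datatype 'v adversary =
    Curious "'v set"
  | Eavesdropper "('v \<times> 'v) set"

fun info :: "'v pair_pre_digraph \<Rightarrow> 'v run \<Rightarrow> 'v adversary \<Rightarrow> nat \<Rightarrow> 'v obs set" where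
  "info G r (Curious N) k =
     {Obs_alpha l a (xa r l k a) | l a. a \<in> N \<and> l \<in> {1, 2}} \<union>
     {Obs_beta l a (xb r l k a) | l a. a \<in> N \<and> l \<in> {1, 2}} \<union>
     {Obs_p h a (p r k h a) | h a. a \<in> N \<and> h \<in> pverts G} \<union>
     {Obs_p a q (p r k a q) | a q. a \<in> N \<and> q \<in> in_nbrs G a} \<union>
     {Obs_alpha l q (xa r l k q) | l a q. a \<in> N \<and> q \<in> in_nbrs G a \<and> l \<in> {1, 2}}"
| "info G r (Eavesdropper ER) k =
     {Obs_alpha l h (xa r l k h) | l i h. (i, h) \<in> ER \<and> l \<in> {1, 2}} \<union>
     {Obs_p i h (p r k i h) | i h. (i, h) \<in> ER}"

definition info_upto ::
  "'v pair_pre_digraph \<Rightarrow> 'v run \<Rightarrow> 'v adversary \<Rightarrow> nat \<Rightarrow> 'v obs set list" where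
  "info_upto G r A K = map (info G r A) [0..<Suc K]"

definition consistent_values ::
  "'v pair_pre_digraph \<Rightarrow> 'v run \<Rightarrow> 'v adversary \<Rightarrow> nat \<Rightarrow> 'v \<Rightarrow> real set" where
  "consistent_values G r A K j =
     {x0 r' j | r'. prftps_run G r' \<and> info_upto G r' A K = info_upto G r A K}"

text \<open>The library's \<open>diameter\<close> is real-valued and therefore 0 on unbounded sets.\<close>

definition Diam :: "real set \<Rightarrow> ereal" where
  "Diam S = (SUP (u, v)\<in>S \<times> S. ereal \<bar>u - v\<bar>)"

end

theory Submission
  imports Defs
begin

text \<open>
  At time 0 the column of weights \<open>p\<^sub>h\<^sub>s(0)\<close> of a node \<open>s\<close> is arbitrary on \<open>s\<close> and its
  out-neighbours, since \<open>a\<^sup>\<beta>\<^sup>\<alpha>\<^sub>s(0)\<close> makes up the difference to the sum 1. The split of the private value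
  of each node into its two substates is arbitrary as well. Hence the same state at time 1 can
  arise from different initial data: whatever a change of the messages sent by \<open>s\<close> adds to a receiver
  \<open>i\<close> can be subtracted from the unshared substate \<open>x\<^sup>\<beta>\<^sub>i\<close>, which enters \<open>x\<^sup>\<alpha>\<^sub>i(1)\<close> with weight 1. From
  time 1 on the weights are prescribed, so the whole run stays as it was provided that \<open>x\<^sup>\<beta>\<^sub>s(1)\<close> does not
  change either (lemma \<open>prftps_run_reroute\<close>). The substates with index 2 are not affected, because \<open>x\<^sup>\<alpha>\<close> with index 2 vanishes at time 0.

  Now let the message from \<open>s\<close> to \<open>t\<close> travel along an edge that the adversary does not observe, and
  let \<open>d\<close> be any real number. The amount \<open>2 d\<close> can be added to this message without a trace, so that
  the private value of \<open>s\<close> grows by \<open>d\<close> and that of \<open>t\<close> shrinks by \<open>d\<close>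
  (lemma \<open>ex_run_shifted_along_hidden_edge\<close>):
  \<^item> if \<open>x\<^sup>\<alpha>\<^sub>s(0) \<noteq> 0\<close>, one moves the weight \<open>2 d / x\<^sup>\<alpha>\<^sub>s(0)\<close> from \<open>p\<^sub>s\<^sub>s(0)\<close> to \<open>p\<^sub>t\<^sub>s(0)\<close>;
  \<^item> if \<open>x\<^sup>\<alpha>\<^sub>s(0) = 0\<close>, then by hypothesis the adversary does not see \<open>x\<^sup>\<alpha>\<^sub>s\<close>. It is then not told any
    weight of the column of \<open>s\<close> either, so one replaces \<open>x\<^sup>\<alpha>\<^sub>s(0)\<close> by \<open>2 d\<close> and sends all of it to \<open>t\<close>.

  Taking \<open>j\<close> as the sender or as the receiver of a hidden edge shows that every real number is
  consistent with the observations, which is more than an infinite diameter.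
\<close>

text \<open>
  The free choices are \<open>\<alpha>\<close> for \<open>x\<^sup>\<alpha>\<^sub>s(0)\<close> and \<open>w\<close> for the time-0 weights of \<open>s\<close>; all other changes
  compensate for these. Letting every node, and not only the ends of one edge, absorb the change of
  the message received from \<open>s\<close> makes the definition independent of a receiver.
\<close>

definition reroute ::
  "'v pair_pre_digraph \<Rightarrow> 'v run \<Rightarrow> 'v \<Rightarrow> real \<Rightarrow> ('v \<Rightarrow> real) \<Rightarrow> 'v run" where
  "reroute G r s \<alpha> w = r\<lparr>
     x0 := \<lambda>i. x0 r i + ((if i = s then \<alpha> - xa r 1 0 s else 0)
                         + (p r 0 i s * xa r 1 0 s - w i * \<alpha>)) / 2,
     xa := \<lambda>l k i. if l = 1 \<and> k = 0 \<and> i = s then \<alpha> else xa r l k i,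
     xb := \<lambda>l k i. if l = 1 \<and> k = 0 then xb r l k i + (p r 0 i s * xa r 1 0 s - w i * \<alpha>)
                   else xb r l k i,
     p := \<lambda>k i h. if k = 0 \<and> h = s then w i else p r k i h,
     a_ba := \<lambda>k i. if k = 0 \<and> i = s then 1 - (\<Sum>h\<in>pverts G. w h) else a_ba r k i\<rparr>"

lemma reroute_simps:
  "x0 (reroute G r s \<alpha> w) i = x0 r i + ((if i = s then \<alpha> - xa r 1 0 s else 0)
     + (p r 0 i s * xa r 1 0 s - w i * \<alpha>)) / 2"
  "xa (reroute G r s \<alpha> w) l k i = (if l = 1 \<and> k = 0 \<and> i = s then \<alpha> else xa r l k i)"
  "xb (reroute G r s \<alpha> w) l k i =
     (if l = 1 \<and> k = 0 then xb r l k i + (p r 0 i s * xa r 1 0 s - w i * \<alpha>) else xb r l k i)"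
  "p (reroute G r s \<alpha> w) k i h = (if k = 0 \<and> h = s then w i else p r k i h)"
  "a_ab (reroute G r s \<alpha> w) k i = a_ab r k i"
  "a_ba (reroute G r s \<alpha> w) k i =
     (if k = 0 \<and> i = s then 1 - (\<Sum>h\<in>pverts G. w h) else a_ba r k i)"
  "a_bb (reroute G r s \<alpha> w) k i = a_bb r k i"
  by (auto simp: reroute_def)

text \<open>
  The unshared substates at time 0 keep every \<open>x\<^sup>\<alpha>\<^sub>i(1)\<close> in place, but \<open>x\<^sup>\<beta>\<^sub>s(1)\<close> does not depend on them,
  since its weight \<open>a\<^sup>\<beta>\<^sup>\<beta>\<close> at time 0 is 0. This is why \<open>beta\<close>, which fixes \<open>x\<^sup>\<beta>\<^sub>s(1)\<close>, is a hypothesis on the new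
  weights.
\<close>

lemma prftps_run_reroute:
  assumes fin: "finite (pverts G)" and s: "s \<in> pverts G" and run: "prftps_run G r"
    and supp: "\<And>h. h \<in> pverts G \<Longrightarrow> h \<notin> insert s (out_nbrs G s) \<Longrightarrow> w h = 0"
    and beta: "(1 - (\<Sum>h\<in>pverts G. w h)) * \<alpha> = a_ba r 0 s * xa r 1 0 s"
  shows "prftps_run G (reroute G r s \<alpha> w)"
proof -
  let ?r = "reroute G r s \<alpha> w"
  have ini: "admissible_init G r" and wts: "admissible_weights G r"
    using run by (auto simp: prftps_run_def)
  have xa2: "xa r 2 0 i = 0" if "i \<in> pverts G" for i
    using ini that by (auto simp: admissible_init_def)
  have ab0: "a_ab r 0 i = 1" "a_bb r 0 i = 0" if "i \<in> pverts G" for i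
    using wts that by (auto simp: admissible_weights_def)
  have step_a: "xa r l (Suc k) i =
      (\<Sum>h\<in>insert i (in_nbrs G i). p r k i h * xa r l k h) + a_ab r k i * xb r l k i"
    and step_b: "xb r l (Suc k) i = a_ba r k i * xa r l k i + a_bb r k i * xb r l k i"
    if "i \<in> pverts G" "l \<in> {1, 2}" for i l k
    using run that unfolding prftps_run_def by blast+
  have "admissible_init G ?r"
    using ini by (auto simp: admissible_init_def reroute_simps field_simps)
  moreover have "admissible_weights G ?r"
    using wts supp by (auto simp: admissible_weights_def reroute_simps)
  moreover have "xa ?r l (Suc k) i =
      (\<Sum>h\<in>insert i (in_nbrs G i). p ?r k i h * xa ?r l k h) + a_ab ?r k i * xb ?r l k i"
    if i: "i \<in> pverts G" and l: "l \<in> {1, 2}" for i l k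
  proof (cases "k = 0 \<and> l = 1")
    case True
    let ?I = "insert i (in_nbrs G i)"
    have finI: "finite ?I" using fin by (auto simp: in_nbrs_def)
    have "(\<Sum>h\<in>?I. p ?r 0 i h * xa ?r 1 0 h) =
        (\<Sum>h\<in>?I. p r 0 i h * xa r 1 0 h + (if h = s then w i * \<alpha> - p r 0 i s * xa r 1 0 s else 0))"
      by (intro sum.cong) (auto simp: reroute_simps)
    also have "\<dots> = (\<Sum>h\<in>?I. p r 0 i h * xa r 1 0 h)
        + (if s \<in> ?I then w i * \<alpha> - p r 0 i s * xa r 1 0 s else 0)"
      using finI by (simp add: sum.distrib sum.delta)
    also have "(if s \<in> ?I then w i * \<alpha> - p r 0 i s * xa r 1 0 s else 0)
        = w i * \<alpha> - p r 0 i s * xa r 1 0 s"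
    proof (cases "s \<in> ?I")
      case False
      \<comment> \<open>A node that is not reached by \<open>s\<close> gets weight 0 before and after.\<close>
      then have ni: "i \<notin> insert s (out_nbrs G s)"
        using s by (auto simp: in_nbrs_def out_nbrs_def)
      then have "p r 0 i s = 0"
        using wts s i by (auto simp: admissible_weights_def)
      then show ?thesis using supp[OF i ni] False by simp
    qed simp
    finally show ?thesis
      using True step_a[OF i, of 1 0] ab0[OF i] by (simp add: reroute_simps)
  next
    case False
    have "(\<Sum>h\<in>insert i (in_nbrs G i). p ?r k i h * xa ?r l k h)
        = (\<Sum>h\<in>insert i (in_nbrs G i). p r k i h * xa r l k h)"
      using False l xa2[OF s] by (intro sum.cong) (auto simp: reroute_simps)
    then show ?thesis
      using False step_a[OF i l, of k] by (auto simp: reroute_simps)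
  qed
  moreover have "xb ?r l (Suc k) i = a_ba ?r k i * xa ?r l k i + a_bb ?r k i * xb ?r l k i"
    if i: "i \<in> pverts G" and l: "l \<in> {1, 2}" for i l k
    using step_b[OF i l, of k] beta ab0[OF i] xa2[OF i] l by (auto simp: reroute_simps)
  ultimately show ?thesis
    unfolding prftps_run_def by blast
qed

text \<open>
  What the adversary has to miss about the edge from \<open>s\<close> to \<open>t\<close>: the weight of that edge, and also
  what absorbs the change at its two ends, namely their unshared substates and the weight
  \<open>p\<^sub>s\<^sub>s(0)\<close>. An eavesdropper on the edges of a loop-free graph never sees the latter.
\<close>

fun edge_hidden :: "'v adversary \<Rightarrow> 'v \<Rightarrow> 'v \<Rightarrow> bool" where
  "edge_hidden (Curious N) t s \<longleftrightarrow> s \<notin> N \<and> t \<notin> N"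
| "edge_hidden (Eavesdropper ER) t s \<longleftrightarrow> (t, s) \<notin> ER \<and> (s, s) \<notin> ER"

lemma info_cong_Curious:
  assumes "\<And>l a. a \<in> N \<Longrightarrow> xa r' l k a = xa r l k a"
    and "\<And>l a. a \<in> N \<Longrightarrow> xb r' l k a = xb r l k a"
    and "\<And>h a. a \<in> N \<Longrightarrow> p r' k h a = p r k h a"
    and "\<And>a q. a \<in> N \<Longrightarrow> q \<in> in_nbrs G a \<Longrightarrow> p r' k a q = p r k a q"
    and "\<And>l a q. a \<in> N \<Longrightarrow> q \<in> in_nbrs G a \<Longrightarrow> xa r' l k q = xa r l k q"
  shows "info G r' (Curious N) k = info G r (Curious N) k"
  unfolding info.simps using assms
  by (intro arg_cong2[where f = "(\<union>)"] Collect_cong) metis+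

lemma info_cong_Eavesdropper:
  assumes "\<And>l i h. (i, h) \<in> ER \<Longrightarrow> xa r' l k h = xa r l k h"
    and "\<And>i h. (i, h) \<in> ER \<Longrightarrow> p r' k i h = p r k i h"
  shows "info G r' (Eavesdropper ER) k = info G r (Eavesdropper ER) k"
  unfolding info.simps using assms
  by (intro arg_cong2[where f = "(\<union>)"] Collect_cong) metis+

text \<open>
  The first alternative of \<open>seen\<close> changes only the weights from \<open>s\<close> to \<open>s\<close> and \<open>t\<close>, which are hidden.
  In the second, the adversary neither receives nor overhears any message of \<open>s\<close>, because \<open>x\<^sup>\<alpha>\<^sub>s\<close>
  would be known with it; hence no weight of \<open>s\<close> is observed.
\<close>

lemma info_reroute:
  assumes hidden: "edge_hidden A t s"
    and msg: "\<And>i. i \<noteq> s \<Longrightarrow> i \<noteq> t \<Longrightarrow> w i * \<alpha> = p r 0 i s * xa r 1 0 s"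
    and seen: "\<alpha> = xa r 1 0 s \<and> (\<forall>i. i \<noteq> s \<longrightarrow> i \<noteq> t \<longrightarrow> w i = p r 0 i s)
      \<or> Obs_alpha 1 s (xa r 1 0 s) \<notin> info G r A 0"
  shows "info G (reroute G r s \<alpha> w) A k = info G r A k"
proof (cases A)
  case (Curious N)
  have st: "s \<notin> N" "t \<notin> N" using hidden Curious by auto
  have sender: "\<alpha> = xa r 1 0 s \<and> w a = p r 0 a s" if "a \<in> N" "s \<in> in_nbrs G a" for a
    using seen that st Curious by fastforce
  show ?thesis unfolding Curious
  proof (rule info_cong_Curious)
    fix l a assume "a \<in> N"
    then show "xb (reroute G r s \<alpha> w) l k a = xb r l k a"
      using msg[of a] st by (cases "a = s"; cases "a = t") (auto simp: reroute_simps)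
  qed (use st sender in \<open>auto simp: reroute_simps\<close>)
next
  case (Eavesdropper ER)
  have ts: "(t, s) \<notin> ER" "(s, s) \<notin> ER" using hidden Eavesdropper by auto
  have sender: "\<alpha> = xa r 1 0 s \<and> w i = p r 0 i s" if "(i, s) \<in> ER" for i
    using seen that ts Eavesdropper by fastforce
  show ?thesis unfolding Eavesdropper
    by (rule info_cong_Eavesdropper) (use sender in \<open>auto simp: reroute_simps\<close>)
qed

text \<open>
  A transfer of \<open>2 d\<close> between the substates moves each private value by \<open>d\<close>, because a private value
  is half the sum of its two substates. The case distinction is on whether \<open>s\<close> has a nonzero
  shared value that a change of weights can act on.
\<close>

lemma ex_run_shifted_along_hidden_edge:
  assumes G: "pair_digraph G" and run: "prftps_run G r"
    and edge: "(t, s) \<in> parcs G"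
    and hidden: "edge_hidden A t s" and zero: "Obs_alpha 1 s 0 \<notin> info G r A 0"
  shows "\<exists>r'. prftps_run G r' \<and> (\<forall>k. info G r' A k = info G r A k) \<and>
           x0 r' s = x0 r s + d \<and> x0 r' t = x0 r t - d"
proof -
  interpret pair_digraph G by (rule G)
  have fin: "finite (pverts G)" by simp
  have st: "s \<in> pverts G" "t \<in> pverts G" "t \<noteq> s"
    using in_arcsD1[OF edge] in_arcsD2[OF edge] no_loops[OF edge] by auto
  have t_out: "t \<in> out_nbrs G s" using st edge by (simp add: out_nbrs_def)
  have wts: "admissible_weights G r" using run by (simp add: prftps_run_def)
  let ?\<alpha> = "xa r 1 0 s"
  show ?thesis
  proof (cases "?\<alpha> = 0")
    case False
    \<comment> \<open>The weight that turns the shared value of \<open>s\<close> into a message of \<open>2 d\<close>.\<close>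
    let ?c = "2 * d / ?\<alpha>"
    let ?w = "\<lambda>i. p r 0 i s + (if i = t then ?c else 0) - (if i = s then ?c else 0)"
    let ?r = "reroute G r s ?\<alpha> ?w"
    have "(\<Sum>h\<in>pverts G. ?w h) = (\<Sum>h\<in>pverts G. p r 0 h s)"
      using st fin by (simp add: sum.distrib sum_subtractf)
    moreover have "(\<Sum>h\<in>pverts G. p r 0 h s) + a_ba r 0 s = 1"
      using wts st by (simp add: admissible_weights_def)
    ultimately have beta: "(1 - (\<Sum>h\<in>pverts G. ?w h)) * ?\<alpha> = a_ba r 0 s * ?\<alpha>"
      by simp
    have "prftps_run G ?r"
      by (rule prftps_run_reroute[OF fin st(1) run _ beta])
        (use wts st t_out in \<open>auto simp: admissible_weights_def\<close>)
    moreover have "info G ?r A k = info G r A k" for k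
      by (rule info_reroute[OF hidden]) auto
    moreover have "x0 ?r s = x0 r s + d" "x0 ?r t = x0 r t - d"
      using st False by (auto simp: reroute_simps field_simps)
    ultimately show ?thesis by blast
  next
    case True
    \<comment> \<open>The total weight 1 leaves no weight for \<open>x\<^sup>\<beta>\<^sub>s(1)\<close>, which is 0 in the given run.\<close>
    let ?w = "\<lambda>i. if i = t then 1 else 0"
    let ?r = "reroute G r s (2 * d) ?w"
    have beta: "(1 - (\<Sum>h\<in>pverts G. ?w h)) * (2 * d) = a_ba r 0 s * ?\<alpha>"
      using True st fin by simp
    have "prftps_run G ?r"
      by (rule prftps_run_reroute[OF fin st(1) run _ beta]) (use t_out in auto)
    moreover have "info G ?r A k = info G r A k" for k
      by (rule info_reroute[OF hidden]) (use True zero in auto)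
    moreover have "x0 ?r s = x0 r s + d" "x0 ?r t = x0 r t - d"
      using st True by (auto simp: reroute_simps field_simps)
    ultimately show ?thesis by blast
  qed
qed

lemma consistent_values_UNIV:
  assumes "pair_digraph G" "prftps_run G r"
    and "(t, s) \<in> parcs G" "edge_hidden A t s" "Obs_alpha 1 s 0 \<notin> info G r A 0"
    and "j = s \<or> j = t"
  shows "consistent_values G r A K j = UNIV"
proof -
  have "v \<in> consistent_values G r A K j" for v
  proof -
    \<comment> \<open>The receiver's value moves in the opposite direction.\<close>
    obtain r' where "prftps_run G r'" "\<forall>k. info G r' A k = info G r A k" "x0 r' j = v"
      using ex_run_shifted_along_hidden_edge[OF assms(1-5), of "v - x0 r s"]
        ex_run_shifted_along_hidden_edge[OF assms(1-5), of "x0 r t - v"] assms(6) by auto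
    then show ?thesis
      by (auto simp: consistent_values_def info_upto_def)
  qed
  then show ?thesis by blast
qed

lemma Diam_UNIV: "Diam UNIV = \<infinity>"
proof (rule ereal_top)
  fix B :: real
  have "ereal \<bar>\<bar>B\<bar> - 0\<bar> \<le> Diam UNIV"
    unfolding Diam_def by (rule SUP_upper2[of "(\<bar>B\<bar>, 0)"]) auto
  then show "ereal B \<le> Diam UNIV"
    by (rule order_trans[rotated]) simp
qed

(* A hidden edge protects j only if the adversary does not see its sender h with
   x^alpha_{h,1}(0) = 0: in that case p_{ih}(0) * x^alpha_{h,1}(0) is known in spite of p_{ih}(0)
   being hidden. Example: messages are sent along j -> a, a -> j, j -> m, m -> a, and N = {a}. If
   xa r 1 0 j = 0, then xb r 1 0 j = xa r 1 1 j - p r 0 j a * xa r 1 0 a, so a learns x0 r j. *)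
theorem theorem2:
  fixes G :: "nat pair_pre_digraph" and n K j :: nat and r :: "nat run"
  assumes "pair_digraph G" and "pverts G = {1..n}" and "strongly_connected (with_proj G)"
    and "j \<in> pverts G"
    and "prftps_run G r"
  shows "(\<forall>N. N \<subseteq> pverts G \<and> j \<notin> N \<and>
            ((\<exists>m\<in>out_nbrs G j. m \<notin> N \<and> Obs_alpha 1 j 0 \<notin> info G r (Curious N) 0) \<or>
             (\<exists>m\<in>in_nbrs G j. m \<notin> N \<and> Obs_alpha 1 m 0 \<notin> info G r (Curious N) 0)) \<longrightarrow>
            Diam (consistent_values G r (Curious N) K j) = \<infinity>) \<and>
         (\<forall>ER. ER \<subseteq> parcs G \<and>
            ((\<exists>m\<in>out_nbrs G j. (m, j) \<notin> ER \<and> Obs_alpha 1 j 0 \<notin> info G r (Eavesdropper ER) 0) \<or>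
             (\<exists>m\<in>in_nbrs G j. (j, m) \<notin> ER \<and> Obs_alpha 1 m 0 \<notin> info G r (Eavesdropper ER) 0)) \<longrightarrow>
            Diam (consistent_values G r (Eavesdropper ER) K j) = \<infinity>)"
proof -
  note infinite_diam =
    consistent_values_UNIV[OF assms(1) assms(5), THEN arg_cong[where f = Diam], unfolded Diam_UNIV]
  have out: "(m, j) \<in> parcs G" if "m \<in> out_nbrs G j" for m
    using that by (simp add: out_nbrs_def)
  have "in": "(j, m) \<in> parcs G" if "m \<in> in_nbrs G j" for m
    using that by (simp add: in_nbrs_def)
  have no_loop: "(i, i) \<notin> ER" if "ER \<subseteq> parcs G" for i ER
  proof -
    interpret pair_digraph G by (rule assms(1))
    show ?thesis using that no_loops[of "(i, i)"] by auto
  qed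
  have curious: "Diam (consistent_values G r (Curious N) K j) = \<infinity>"
    if "j \<notin> N" and
      "(\<exists>m\<in>out_nbrs G j. m \<notin> N \<and> Obs_alpha 1 j 0 \<notin> info G r (Curious N) 0) \<or>
       (\<exists>m\<in>in_nbrs G j. m \<notin> N \<and> Obs_alpha 1 m 0 \<notin> info G r (Curious N) 0)" for N
    using that(2)
  proof (elim disjE bexE conjE)
    fix m assume "m \<in> out_nbrs G j" "m \<notin> N" "Obs_alpha 1 j 0 \<notin> info G r (Curious N) 0"
    then show ?thesis using that(1) by (intro infinite_diam[OF out]) auto
  next
    fix m assume "m \<in> in_nbrs G j" "m \<notin> N" "Obs_alpha 1 m 0 \<notin> info G r (Curious N) 0"
    then show ?thesis using that(1) by (intro infinite_diam[OF "in"]) auto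
  qed
  have eavesdropper: "Diam (consistent_values G r (Eavesdropper ER) K j) = \<infinity>"
    if "ER \<subseteq> parcs G" and
      "(\<exists>m\<in>out_nbrs G j. (m, j) \<notin> ER \<and> Obs_alpha 1 j 0 \<notin> info G r (Eavesdropper ER) 0) \<or>
       (\<exists>m\<in>in_nbrs G j. (j, m) \<notin> ER \<and> Obs_alpha 1 m 0 \<notin> info G r (Eavesdropper ER) 0)" for ER
    using that(2)
  proof (elim disjE bexE conjE)
    fix m assume "m \<in> out_nbrs G j" "(m, j) \<notin> ER"
      "Obs_alpha 1 j 0 \<notin> info G r (Eavesdropper ER) 0"
    then show ?thesis using no_loop[OF that(1)] by (intro infinite_diam[OF out]) auto
  next
    fix m assume "m \<in> in_nbrs G j" "(j, m) \<notin> ER"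
      "Obs_alpha 1 m 0 \<notin> info G r (Eavesdropper ER) 0"
    then show ?thesis using no_loop[OF that(1)] by (intro infinite_diam[OF "in"]) auto
  qed
  show ?thesis
    by (intro conjI allI impI; elim conjE)
      (rule curious, assumption+, rule eavesdropper, assumption+)
qed

end
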